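(* For every admissible monomial ordering $\succ$ on the set $\mathbb{M}$ of monomials in $x_1,\dots,x_n$, the division $D_\succ$ induced by $\succ$ is noetherian, continuous and constructive.
   Context: $\mathbb{M}=\{x_1^{d_1}\cdots x_n^{d_n}\mid d_i\in\mathbb{Z}_{\ge 0}\}$ is the monoid of monomials, and $\deg_i(u)$ is the degree of $x_i$ in $u$. An admissible monomial ordering is a total ordering on $\mathbb{M}$, compatible with multiplication, in which $1$ is the smallest element. All monomial sets are finite. Involutive division: an involutive division $L$ on $\mathbb{M}$ assigns to any finite $U\subset\mathbb{M}$ and $u\in U$ a submonoid $L(u,U)$ of $\mathbb{M}$ such that: (a) if $w\in L(u,U)$ and $v\mid w$, then $v\in L(u,U)$; (b) if $u,v\in U$ and $uL(u,U)\cap vL(v,U)\neq\emptyset$, then $u\in vL(v,U)$ or $v\in uL(u,U)$; (c) if $v\in U$ and $v\in uL(u,U)$, then $L(v,U)\subseteq L(u,U)$; (d) if $V\subseteq U$, then $L(u,U)\subseteq L(u,V)$ for all $u\in V$. The variables lying in $L(u,U)$ are the multiplicative variables of $u$; their set is $M_L(u,U)$, and the set of the remaining (nonmultiplicative) variables is $NM_L(u,U)$. For $u\in U$ write $u\mid_L w$ if $w\in uL(u,U)$; then $u$ is an involutive divisor of $w$ in $U$. The notation $u\cdot x$ with $x\in NM_L(u,U)$ denotes the product, called a nonmultiplicative prolongation. Induced division $D_\succ$: $x_i$ is nonmultiplicative for $u\in U$ if there is $v\in U$ with $v\prec u$ and $\deg_i(u)<\deg_i(v)$, and multiplicative otherwise;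 $D_\succ(u,U)$ is the submonoid generated by the multiplicative variables of $u$. This is an involutive division. Cones: $C(U)=\bigcup_{u\in U}u\mathbb{M}$ and $C_L(U)=\bigcup_{u\in U}uL(u,U)$. A set $U$ is $L$-involutive if $C(U)=C_L(U)$. Noetherian: a finite $L$-involutive set $\tilde U\supseteq U$ with $C(\tilde U)=C(U)$ is called a finite $L$-completion of $U$; $U$ is finitely generated with respect to $L$ if it has a finite $L$-completion; $L$ is noetherian if every finite set $U\subset\mathbb{M}$ is finitely generated with respect to $L$. Continuous: $L$ is continuous if for any finite set $U\subset\mathbb{M}$ and any finite sequence $u_1,\dots,u_k$ of elements of $U$ such that for every $i<k$ there is $x_j\in NM_L(u_i,U)$ with $u_{i+1}\mid_L u_i\cdot x_j$, one has $u_i\ne u_j$ for $i\ne j$. Constructive: a continuous involutive division $L$ is constructive if for any finite $U\subset\mathbb{M}$, $u\in U$, $x_i\in NM_L(u,U)$ such that $u\cdot x_i$ has no involutive divisors in $U$ and such that every $v\in U$, $x_j\in NM_L(v,U)$ with $v\cdot x_j\mid u\cdot x_i$ and $v\cdot x_j\ne u\cdot x_i$ satisfy $v\cdot x_j\in C_L(U)$, the following holds: for all $w\in C_L(U)$, $u\cdot x_i\notin wL(w,U\cup\{w\})$. *)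

theory Defs
  imports "HOL-Library.Poly_Mapping" "HOL.Hull"
begin

text \<open>
  Monomials are represented by their exponent vectors, so the monoid of monomials is written
  additively: \<open>u + v\<close> is the product of monomials, \<open>0\<close> is the monomial \<open>1\<close>, and
  \<open>deg i u\<close> is the degree of the \<open>i\<close>-th variable in \<open>u\<close>. The variables are indexed by a
  finite type \<open>'x\<close>, so that their number is \<open>CARD('x)\<close>.
\<close>

type_synonym 'x mon = "'x \<Rightarrow>\<^sub>0 nat"

abbreviation deg :: "'x \<Rightarrow> 'x mon \<Rightarrow> nat" where
  "deg i u \<equiv> Poly_Mapping.lookup u i"

abbreviation var :: "'x \<Rightarrow> 'x mon" where
  "var i \<equiv> Poly_Mapping.single i 1"

definition mon_dvd :: "'x mon \<Rightarrow> 'x mon \<Rightarrow> bool"  (infix "divides" 50) where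
  "u divides w \<longleftrightarrow> (\<exists>v. w = u + v)"

definition submon :: "'x mon set \<Rightarrow> bool" where
  "submon S \<longleftrightarrow> 0 \<in> S \<and> (\<forall>u\<in>S. \<forall>v\<in>S. u + v \<in> S)"

text \<open>The argument is the strict part of the ordering.\<close>

definition admissible_ordering :: "('x mon \<Rightarrow> 'x mon \<Rightarrow> bool) \<Rightarrow> bool" where
  "admissible_ordering prec \<longleftrightarrow>
     class.linorder (\<lambda>u v. prec u v \<or> u = v) prec \<and>
     (\<forall>u v w. prec u v \<longrightarrow> prec (u + w) (v + w)) \<and>
     (\<forall>u. u \<noteq> 0 \<longrightarrow> prec 0 u)"

text \<open>
  A division is a function \<open>L u U\<close>; only its values at finite \<open>U\<close> and \<open>u \<in> U\<close> are meaningful.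
\<close>

type_synonym 'x division = "'x mon \<Rightarrow> 'x mon set \<Rightarrow> 'x mon set"

text \<open>The set \<open>u L(u,U)\<close>.\<close>

definition inv_cone1 :: "'x division \<Rightarrow> 'x mon \<Rightarrow> 'x mon set \<Rightarrow> 'x mon set" where
  "inv_cone1 L u U = (\<lambda>m. u + m) ` L u U"

definition involutive_division :: "'x division \<Rightarrow> bool" where
  "involutive_division L \<longleftrightarrow>
     (\<forall>U. finite U \<longrightarrow>
        (\<forall>u\<in>U. submon (L u U)) \<and>
        (\<forall>u\<in>U. \<forall>w\<in>L u U. \<forall>v. v divides w \<longrightarrow> v \<in> L u U) \<and>
        (\<forall>u\<in>U. \<forall>v\<in>U. inv_cone1 L u U \<inter> inv_cone1 L v U \<noteq> {} \<longrightarrow>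
            u \<in> inv_cone1 L v U \<or> v \<in> inv_cone1 L u U) \<and>
        (\<forall>u\<in>U. \<forall>v\<in>U. v \<in> inv_cone1 L u U \<longrightarrow> L v U \<subseteq> L u U) \<and>
        (\<forall>V. V \<subseteq> U \<longrightarrow> (\<forall>u\<in>V. L u U \<subseteq> L u V)))"

definition nonmult_vars :: "'x division \<Rightarrow> 'x mon \<Rightarrow> 'x mon set \<Rightarrow> 'x set" where
  "nonmult_vars L u U = {i. var i \<notin> L u U}"

definition inv_dvd :: "'x division \<Rightarrow> 'x mon set \<Rightarrow> 'x mon \<Rightarrow> 'x mon \<Rightarrow> bool" where
  "inv_dvd L U u w \<longleftrightarrow> w \<in> inv_cone1 L u U"

definition cone :: "'x mon set \<Rightarrow> 'x mon set" where
  "cone U = (\<Union>u\<in>U. range (\<lambda>m. u + m))"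

definition inv_cone :: "'x division \<Rightarrow> 'x mon set \<Rightarrow> 'x mon set" where
  "inv_cone L U = (\<Union>u\<in>U. inv_cone1 L u U)"

definition involutive_set :: "'x division \<Rightarrow> 'x mon set \<Rightarrow> bool" where
  "involutive_set L U \<longleftrightarrow> cone U = inv_cone L U"

definition finite_completion :: "'x division \<Rightarrow> 'x mon set \<Rightarrow> 'x mon set \<Rightarrow> bool" where
  "finite_completion L U W \<longleftrightarrow>
     finite W \<and> involutive_set L W \<and> U \<subseteq> W \<and> cone W = cone U"

definition finitely_generated :: "'x division \<Rightarrow> 'x mon set \<Rightarrow> bool" where
  "finitely_generated L U \<longleftrightarrow> (\<exists>W. finite_completion L U W)"

text \<open>
  The following three properties are only defined for involutive divisions, whence the first
  conjunct.
\<close>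

definition noetherian_division :: "'x division \<Rightarrow> bool" where
  "noetherian_division L \<longleftrightarrow>
     involutive_division L \<and> (\<forall>U. finite U \<longrightarrow> finitely_generated L U)"

definition continuous_division :: "'x division \<Rightarrow> bool" where
  "continuous_division L \<longleftrightarrow>
     involutive_division L \<and>
     (\<forall>U us. finite U \<and> set us \<subseteq> U \<and>
        (\<forall>k. Suc k < length us \<longrightarrow>
           (\<exists>j\<in>nonmult_vars L (us ! k) U. inv_dvd L U (us ! Suc k) (us ! k + var j)))
        \<longrightarrow> distinct us)"

definition constructive_division :: "'x division \<Rightarrow> bool" where
  "constructive_division L \<longleftrightarrow>
     involutive_division L \<and> continuous_division L \<and>
     (\<forall>U u i. finite U \<and> u \<in> U \<and> i \<in> nonmult_vars L u U \<and>
        (\<not> (\<exists>v\<in>U. inv_dvd L U v (u + var i))) \<and>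
        (\<forall>v\<in>U. \<forall>j\<in>nonmult_vars L v U.
           v + var j divides u + var i \<and> v + var j \<noteq> u + var i \<longrightarrow> v + var j \<in> inv_cone L U)
        \<longrightarrow> (\<forall>w\<in>inv_cone L U. u + var i \<notin> inv_cone1 L w (insert w U)))"

definition induced_nonmult ::
    "('x mon \<Rightarrow> 'x mon \<Rightarrow> bool) \<Rightarrow> 'x mon \<Rightarrow> 'x mon set \<Rightarrow> 'x set" where
  "induced_nonmult prec u U = {i. \<exists>v\<in>U. prec v u \<and> deg i u < deg i v}"

definition induced_division :: "('x mon \<Rightarrow> 'x mon \<Rightarrow> bool) \<Rightarrow> 'x division" where
  "induced_division prec u U = submon hull (var ` (- induced_nonmult prec u U))"

end

theory Submission
  imports Defs "HOL-Library.FuncSet"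
begin

text \<open>
  A monomial \<open>w\<close> lies in the involutive cone of \<open>u\<close> exactly if \<open>u\<close> divides \<open>w\<close> and both have the
  same degree in every nonmultiplicative variable of \<open>u\<close>. After this translation all arguments are
  about comparing exponents, and two simple observations carry them.

  First, a variable \<open>i\<close> is made nonmultiplicative for \<open>u\<close> by a witness \<open>t \<prec> u\<close> with
  \<open>deg i u < deg i t\<close>. If \<open>w\<close> is in the involutive cone of \<open>u\<close>, then \<open>u \<preceq> w\<close> and
  \<open>deg i w = deg i u\<close>, so the same \<open>t\<close> is a witness for \<open>w\<close>: passing to a point of the cone can
  only lose multiplicative variables (\<open>induced_nonmult_mono\<close>). This gives the third axiom of an
  involutive division. It also gives constructivity, because \<open>w\<close> in the cone of some \<open>v\<close> in \<open>U\<close>,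
  once adjoined to \<open>U\<close>, has only involutive multiples which are already involutive multiples of \<open>v\<close>.

  Second, a witness is a barrier for the degree. Let \<open>t \<in> U\<close> precede all elements of a sequence of
  nonmultiplicative prolongations and involutive divisors. An element \<open>v\<close> of the sequence with
  \<open>deg j v < deg j t\<close> has \<open>j\<close> nonmultiplicative, and therefore inherits its \<open>j\<close>-degree from the
  prolongation that it divides. So the \<open>j\<close>-degree cut off at \<open>deg j t\<close> never decreases
  (\<open>capped_deg_step\<close>). On a cycle, take for \<open>j\<close> and \<open>t\<close> the variable that prolongs the smallest
  element and its witness: there the cut-off degree strictly increases, which is impossible.

  For noetherianity, let \<open>h\<close> be a common multiple of \<open>U\<close>. The monomials of the cone of \<open>U\<close> that
  divide \<open>h\<close> form a completion: any \<open>m\<close> in the cone has the involutive divisor \<open>gcd m h\<close>, since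
  where this has smaller degree than \<open>m\<close> it already attains the bound given by \<open>h\<close>, and no element
  of the completion exceeds that bound.
\<close>

section \<open>Exponents and submonoids generated by variables\<close>

lemma divides_iff_deg_le: "u divides w \<longleftrightarrow> (\<forall>i. deg i u \<le> deg i w)"
proof
  assume "u divides w"
  then show "\<forall>i. deg i u \<le> deg i w"
    by (auto simp: mon_dvd_def lookup_add)
next
  assume "\<forall>i. deg i u \<le> deg i w"
  then have "w = u + (w - u)"
    by (intro poly_mapping_eqI) (simp add: lookup_add lookup_minus)
  then show "u divides w"
    unfolding mon_dvd_def by blast
qed

lemma submon_hull_vars: "submon hull (var ` A) = {w. Poly_Mapping.keys w \<subseteq> A}"
proof (rule hull_unique)
  show "var ` A \<subseteq> {w. Poly_Mapping.keys w \<subseteq> A}"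
    by auto
  show "submon {w. Poly_Mapping.keys w \<subseteq> A}"
    using keys_add unfolding submon_def by fastforce
next
  fix S :: "'a mon set"
  assume vars: "var ` A \<subseteq> S" and "submon S"
  then have zero: "0 \<in> S" and add: "\<And>u v. u \<in> S \<Longrightarrow> v \<in> S \<Longrightarrow> u + v \<in> S"
    by (auto simp: submon_def)
  have single: "Poly_Mapping.single i n \<in> S" if "i \<in> A" for i n
  proof (induction n)
    case (Suc n)
    have "Poly_Mapping.single i (Suc n) = var i + Poly_Mapping.single i n"
      by (simp flip: single_add)
    then show ?case
      using add Suc vars that by auto
  qed (simp add: zero)
  show "{w. Poly_Mapping.keys w \<subseteq> A} \<subseteq> S"
  proof (intro subsetI, drule CollectD)
    fix w :: "'a mon"
    assume w: "Poly_Mapping.keys w \<subseteq> A"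
    have "(\<Sum>i\<in>B. Poly_Mapping.single i (deg i w)) \<in> S" if "finite B" "B \<subseteq> A" for B
      using that by (induction B rule: finite_induct) (auto intro: zero add single)
    then have "(\<Sum>i\<in>Poly_Mapping.keys w. Poly_Mapping.single i (deg i w)) \<in> S"
      using w by simp
    moreover have "w = (\<Sum>i\<in>Poly_Mapping.keys w. Poly_Mapping.single i (deg i w))"
      by (rule poly_mapping_eqI) (simp add: lookup_sum lookup_single when_def in_keys_iff)
    ultimately show "w \<in> S"
      by simp
  qed
qed

lemma induced_division_eq:
  "induced_division prec u U = {w. \<forall>i\<in>induced_nonmult prec u U. deg i w = 0}"
  unfolding induced_division_def submon_hull_vars by (auto simp: in_keys_iff)

lemma nonmult_vars_induced [simp]:
  "nonmult_vars (induced_division prec) u U = induced_nonmult prec u U"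
  by (auto simp: nonmult_vars_def induced_division_eq lookup_single when_def)

lemma in_induced_cone_iff:
  "w \<in> inv_cone1 (induced_division prec) u U \<longleftrightarrow>
     u divides w \<and> (\<forall>i\<in>induced_nonmult prec u U. deg i w = deg i u)"
  by (auto simp: inv_cone1_def induced_division_eq mon_dvd_def lookup_add image_iff)

section \<open>Admissible orderings\<close>

context
  fixes prec :: "'x mon \<Rightarrow> 'x mon \<Rightarrow> bool"
  assumes adm: "admissible_ordering prec"
begin

lemma adm_linorder: "class.linorder (\<lambda>u v. prec u v \<or> u = v) prec"
  using adm by (simp add: admissible_ordering_def)

lemma adm_trans: "prec u v \<Longrightarrow> prec v w \<Longrightarrow> prec u w"
proof -
  interpret linorder "\<lambda>u v. prec u v \<or> u = v" prec
    by (rule adm_linorder)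
  show "prec u v \<Longrightarrow> prec v w \<Longrightarrow> prec u w"
    by (rule less_trans)
qed

lemma adm_total: "prec u v \<or> u = v \<or> prec v u"
  using linorder.less_linear[OF adm_linorder] .

lemma adm_divides:
  assumes "u divides v"
  shows "prec u v \<or> u = v"
proof -
  obtain m where m: "v = u + m"
    using assms by (auto simp: mon_dvd_def)
  show ?thesis
  proof (cases "m = 0")
    case False
    then have "prec (0 + u) (m + u)"
      using adm unfolding admissible_ordering_def by blast
    then show ?thesis
      using m by (simp add: add.commute)
  qed (simp add: m)
qed

lemma adm_finite_minimal:
  assumes "finite A" "A \<noteq> {}"
  obtains p where "p \<in> A" "\<And>v. v \<in> A \<Longrightarrow> prec p v \<or> p = v"
  using linorder.Min_in[OF adm_linorder assms] linorder.Min_le[OF adm_linorder assms(1)] by blast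

section \<open>The axioms of an involutive division\<close>

text \<open>
  The degree in a nonmultiplicative variable is constant on the cone of \<open>v\<close>, and the ordering grows
  along divisibility, so a witness for \<open>v\<close> remains one for \<open>w\<close>. The two sets \<open>U\<close> and \<open>W\<close> differ in
  the application to constructivity, where \<open>w\<close> is adjoined to \<open>U\<close>.
\<close>

lemma induced_nonmult_mono:
  assumes w: "w \<in> inv_cone1 (induced_division prec) v U" and "U \<subseteq> W"
  shows "induced_nonmult prec v U \<subseteq> induced_nonmult prec w W"
proof
  fix i
  assume i: "i \<in> induced_nonmult prec v U"
  then obtain t where t: "t \<in> U" "prec t v" "deg i v < deg i t"
    by (auto simp: induced_nonmult_def)
  have "prec t w"
    using adm_divides[of v w] w t(2) adm_trans by (auto simp: in_induced_cone_iff)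
  moreover have "deg i w = deg i v"
    using w i by (auto simp: in_induced_cone_iff)
  ultimately show "i \<in> induced_nonmult prec w W"
    using t \<open>U \<subseteq> W\<close> by (auto simp: induced_nonmult_def)
qed

text \<open>
  Where the larger generator \<open>v\<close> had a smaller degree than \<open>u\<close>, its degree could not grow towards
  the common multiple \<open>w\<close>, which has at least the degree of \<open>u\<close>; hence \<open>u\<close> divides \<open>v\<close>, and
  \<open>v\<close> lies between \<open>u\<close> and \<open>w\<close>.
\<close>

lemma induced_cones_intersect:
  assumes u: "u \<in> U" "w \<in> inv_cone1 (induced_division prec) u U"
    and v: "w \<in> inv_cone1 (induced_division prec) v U"
    and "prec u v"
  shows "v \<in> inv_cone1 (induced_division prec) u U"
proof -
  have le: "deg i u \<le> deg i w" "deg i v \<le> deg i w" for i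
    using u v by (auto simp: in_induced_cone_iff divides_iff_deg_le)
  have "deg i u \<le> deg i v" for i
  proof (rule ccontr)
    assume less: "\<not> deg i u \<le> deg i v"
    then have "i \<in> induced_nonmult prec v U"
      using u \<open>prec u v\<close> by (auto simp: induced_nonmult_def)
    then have "deg i w = deg i v"
      using v by (simp add: in_induced_cone_iff)
    then show False
      using less le(1)[of i] by simp
  qed
  moreover have "deg i v = deg i u" if "i \<in> induced_nonmult prec u U" for i
    using u(2) that le(2)[of i] \<open>deg i u \<le> deg i v\<close> by (auto simp: in_induced_cone_iff)
  ultimately show ?thesis
    by (simp add: in_induced_cone_iff divides_iff_deg_le)
qed

lemma involutive_induced_division: "involutive_division (induced_division prec)"
  (is "involutive_division ?D")
  unfolding involutive_division_def
proof (intro allI impI conjI ballI)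
  fix U u
  show "submon (?D u U)"
    by (simp add: submon_def induced_division_eq lookup_add)
next
  fix U u w v
  assume "w \<in> ?D u U" "v divides w"
  then show "v \<in> ?D u U"
    by (auto simp: induced_division_eq mon_dvd_def lookup_add)
next
  fix U u v
  assume uv: "u \<in> U" "v \<in> U" and "inv_cone1 ?D u U \<inter> inv_cone1 ?D v U \<noteq> {}"
  then obtain w where "w \<in> inv_cone1 ?D u U" "w \<in> inv_cone1 ?D v U"
    by blast
  with uv show "u \<in> inv_cone1 ?D v U \<or> v \<in> inv_cone1 ?D u U"
    using adm_total[of u v] induced_cones_intersect[of u U w v]
      induced_cones_intersect[of v U w u]
    by (auto simp: in_induced_cone_iff divides_iff_deg_le)
next
  fix U u v
  assume "v \<in> inv_cone1 ?D u U"
  then have "induced_nonmult prec u U \<subseteq> induced_nonmult prec v U"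
    using induced_nonmult_mono by blast
  then show "?D v U \<subseteq> ?D u U"
    by (auto simp: induced_division_eq)
next
  fix U V :: "'x mon set" and u
  assume "V \<subseteq> U"
  then show "?D u U \<subseteq> ?D u V"
    by (auto simp: induced_division_eq induced_nonmult_def)
qed

section \<open>Continuity\<close>

lemma capped_deg_step:
  assumes "t \<in> U" "prec t v" and v: "inv_dvd (induced_division prec) U v (u + m)"
  shows "min (deg j (u + m)) (deg j t) \<le> min (deg j v) (deg j t)"
proof (cases "deg j v < deg j t")
  case True
  then have "j \<in> induced_nonmult prec v U"
    using assms by (auto simp: induced_nonmult_def)
  then have "deg j (u + m) = deg j v"
    using v by (simp add: inv_dvd_def in_induced_cone_iff)
  then show ?thesis by simp
qed simp

text \<open>
  The argument starts at the smallest element of a supposed cycle, so that its witness precedes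
  every element and bounds the cut-off degree all the way round.
\<close>

lemma continuous_induced_division: "continuous_division (induced_division prec)"
  (is "continuous_division ?D")
proof -
  have "distinct us"
    if us: "set us \<subseteq> U"
      and steps: "\<And>k. Suc k < length us \<Longrightarrow>
        \<exists>j\<in>nonmult_vars ?D (us ! k) U. inv_dvd ?D U (us ! Suc k) (us ! k + var j)"
    for us U
  proof (rule ccontr)
    assume "\<not> distinct us"
    then obtain a b where ab: "a < b" "b < length us" "us ! a = us ! b"
      by (metis distinct_conv_nth linorder_neqE_nat)
    obtain p where p: "p \<in> (!) us ` {a..<b}"
      and p_min: "\<And>v. v \<in> (!) us ` {a..<b} \<Longrightarrow> prec p v \<or> p = v"
      using adm_finite_minimal[of "(!) us ` {a..<b}"] ab(1) by auto
    obtain c where c: "a \<le> c" "c < b" "p = us ! c"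
      using p by auto
    obtain j where j: "j \<in> induced_nonmult prec p U"
      and next_c: "inv_dvd ?D U (us ! Suc c) (p + var j)"
      using steps[of c] c ab by auto
    obtain t where t: "t \<in> U" "prec t p" "deg j p < deg j t"
      using j by (auto simp: induced_nonmult_def)
    have t_below: "prec t (us ! k)" if "a \<le> k" "k \<le> b" for k
    proof -
      have "us ! k \<in> (!) us ` {a..<b}"
      proof (cases "k = b")
        case True
        then have "us ! k = us ! a"
          using ab by simp
        then show ?thesis
          using ab(1) by auto
      qed (use that in auto)
      then show ?thesis
        using p_min t(2) adm_trans by blast
    qed
    define g where "g k = min (deg j (us ! k)) (deg j t)" for k
    have g_Suc: "g k \<le> g (Suc k)" if k: "a \<le> k" "k < b" for k
    proof -
      obtain i where i: "inv_dvd ?D U (us ! Suc k) (us ! k + var i)"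
        using steps[of k] k(2) ab(2) by force
      have "g k \<le> min (deg j (us ! k + var i)) (deg j t)"
        by (auto simp: g_def lookup_add)
      also have "\<dots> \<le> g (Suc k)"
        using capped_deg_step[OF t(1) t_below i] k by (auto simp: g_def)
      finally show ?thesis .
    qed
    have g_mono: "g k \<le> g l" if "k \<le> l" "a \<le> k" "l \<le> b" for k l
      using that
    proof (induction l rule: dec_induct)
      case (step n)
      then show ?case
        using g_Suc[of n] by simp
    qed simp
    have "g c < min (deg j (p + var j)) (deg j t)"
      using t c(3) by (simp add: g_def lookup_add)
    also have "\<dots> \<le> g (Suc c)"
      using capped_deg_step[OF t(1) t_below next_c] c by (simp add: g_def)
    also have "\<dots> \<le> g b"
      using g_mono c by simp
    also have "\<dots> = g a"
      using ab by (simp add: g_def)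
    also have "\<dots> \<le> g c"
      using g_mono c by simp
    finally show False by simp
  qed
  then show ?thesis
    unfolding continuous_division_def
    by (intro conjI allI impI involutive_induced_division) (elim conjE, simp)
qed

section \<open>Constructivity\<close>

text \<open>
  Adjoining a point \<open>w\<close> of the cone of \<open>v\<close> produces no new involutive multiples: by
  \<open>induced_nonmult_mono\<close> the multiplicative variables of \<open>w\<close> are
  multiplicative for \<open>v\<close> as well.
\<close>

lemma induced_cone_insert:
  assumes w: "w \<in> inv_cone1 (induced_division prec) v U"
    and y: "y \<in> inv_cone1 (induced_division prec) w (insert w U)"
  shows "y \<in> inv_cone1 (induced_division prec) v U"
proof -
  have "induced_nonmult prec v U \<subseteq> induced_nonmult prec w (insert w U)"
    using induced_nonmult_mono[OF w] by blast
  moreover have "v divides y"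
    using w y by (meson divides_iff_deg_le in_induced_cone_iff order_trans)
  ultimately show ?thesis
    using w y by (auto simp: in_induced_cone_iff)
qed

lemma constructive_induced_division: "constructive_division (induced_division prec)"
  (is "constructive_division ?D")
proof -
  have "y \<notin> inv_cone1 ?D w (insert w U)"
    if "\<not> (\<exists>v\<in>U. inv_dvd ?D U v y)" "w \<in> inv_cone ?D U" for U y w
    using that induced_cone_insert[of w _ U y] by (auto simp: inv_cone_def inv_dvd_def)
  then show ?thesis
    by (simp add: constructive_division_def involutive_induced_division continuous_induced_division)
qed

end

section \<open>Noetherianity\<close>

lemma finite_mon_le: "finite {w :: 'x::finite mon. w divides h}"
proof (rule finite_imageD)
  have "Poly_Mapping.lookup ` {w. w divides h} \<subseteq> (\<Pi>\<^sub>E i\<in>UNIV. {..deg i h})"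
    by (auto simp: divides_iff_deg_le)
  then show "finite (Poly_Mapping.lookup ` {w. w divides h})"
    by (rule finite_subset) (simp add: finite_PiE)
  show "inj_on Poly_Mapping.lookup {w. w divides h}"
    by (auto intro: inj_onI poly_mapping_eqI)
qed

lemma in_cone_iff: "w \<in> cone U \<longleftrightarrow> (\<exists>u\<in>U. u divides w)"
  by (auto simp: cone_def mon_dvd_def)

lemma inv_cone_subset_cone: "inv_cone L U \<subseteq> cone U"
  by (auto simp: inv_cone_def inv_cone1_def cone_def)

lemma finitely_generated_induced:
  fixes U :: "'x::finite mon set"
  assumes "finite U"
  shows "finitely_generated (induced_division prec) U"
proof -
  define h where "h = \<Sum>U"
  have U_h: "u divides h" if "u \<in> U" for u
    using sum.remove[OF assms that, of id] by (auto simp: h_def mon_dvd_def)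
  define W where "W = {w \<in> cone U. w divides h}"
  have "finite W"
    using finite_mon_le[of h] by (auto simp: W_def)
  have "U \<subseteq> W"
    using U_h by (auto simp: W_def in_cone_iff divides_iff_deg_le)
  have cone_W: "cone W = cone U"
  proof
    show "cone W \<subseteq> cone U"
      by (auto simp: W_def in_cone_iff divides_iff_deg_le) (meson order_trans)
    show "cone U \<subseteq> cone W"
      using \<open>U \<subseteq> W\<close> by (auto simp: cone_def)
  qed
  have "m \<in> inv_cone (induced_division prec) W" if m: "m \<in> cone U" for m
  proof -
    \<comment> \<open>As subtraction of exponents is truncated, this is the greatest common divisor of \<open>m\<close> and \<open>h\<close>.\<close>
    define d where "d = m - (m - h)"
    have deg_d: "deg i d = min (deg i m) (deg i h)" for i
      by (simp add: d_def lookup_minus min_def)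
    obtain u where "u \<in> U" "u divides m"
      using m by (auto simp: in_cone_iff)
    then have "d \<in> W"
      using U_h[of u] by (auto simp: W_def in_cone_iff divides_iff_deg_le deg_d)
    moreover have "m \<in> inv_cone1 (induced_division prec) d W"
      unfolding in_induced_cone_iff
    proof (intro conjI ballI)
      show "d divides m"
        by (simp add: divides_iff_deg_le deg_d)
      fix i
      assume "i \<in> induced_nonmult prec d W"
      then obtain t where "t divides h" "deg i d < deg i t"
        by (auto simp: induced_nonmult_def W_def)
      then have "deg i d < deg i h"
        by (meson divides_iff_deg_le less_le_trans)
      then show "deg i m = deg i d"
        by (simp add: deg_d min_def split: if_splits)
    qed
    ultimately show ?thesis
      by (auto simp: inv_cone_def)
  qed
  then have "involutive_set (induced_division prec) W"
    using cone_W inv_cone_subset_cone unfolding involutive_set_def by blast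
  then show ?thesis
    using \<open>finite W\<close> \<open>U \<subseteq> W\<close> cone_W
    unfolding finitely_generated_def finite_completion_def by blast
qed

theorem proposition3p12:
  fixes prec :: "'x::finite mon \<Rightarrow> 'x mon \<Rightarrow> bool"
  assumes "admissible_ordering prec"
  shows "noetherian_division (induced_division prec) \<and>
         continuous_division (induced_division prec) \<and>
         constructive_division (induced_division prec)"
  using involutive_induced_division[OF assms] continuous_induced_division[OF assms]
    constructive_induced_division[OF assms] finitely_generated_induced
  unfolding noetherian_division_def by blast

end
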